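(* Let $Q=sat(u,l)$, where $u$ is a representation of a propositional formula in CNF and $l$ is the list of the variables in $u$, and let $T$ be a pruned SLD-tree with root $Q$ for the programs $\Pi_1,\ldots,\Pi_5$ (a partition of $P_3$) via a c-selection rule that implements the control described in the context. Then $T$ is complete with respect to $S_3^0$; that is, for every ground instance $Q\theta$ of $Q$, if $Q\theta\in S_3^0$ then $Q\theta$ is an instance of an answer of $T$.
   Context: A fixed alphabet of function and predicate symbols is assumed, containing at least those occurring below; $\mathcal{HU}$ is the Herbrand universe (all ground terms). Prolog list notation is used ($[\,]$ is a constant, $[h|t]$ a binary constructor); $-$ is a binary function symbol written infix; $\mathtt{true},\mathtt{false}$ are constants. Representation of CNF formulae: propositional variables are represented as logical variables; a positive literal $x$ is represented as the term $\mathtt{true}-X$, a negative literal $\neg x$ as $\mathtt{false}-X$; a clause is represented as the list of the representations of its literals, and a conjunction of clauses as the list of the representations of the clauses. The definite clause program $P_3$ consists of the following rules (names beginning with upper-case letters are variables): 1. $sat\_cnf([\,])$. 2. $sat\_cnf([C|Cs])\gets sat\_cl(C), sat\_cnf(Cs)$. 3. $sat\_cl([P-V|R])\gets sat\_cl3(R,V,P)$. 4. ${=}(X,X)$. 5. $sat\_cl3([\,],V,P)\gets V=P$. 6. $sat\_cl3([P_2-V_2|R],V_1,P_1)\gets sat\_cl5(V_1,P_1,V_2,P_2,R)$. 7. $sat\_cl5(V_1,P_1,V_2,P_2,R)\gets sat\_cl5a(V_1,P_1,V_2,P_2,R)$. 8. $sat\_cl5(V_1,P_1,V_2,P_2,R)\gets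 sat\_cl5a(V_2,P_2,V_1,P_1,R)$. 9. $sat\_cl5a(V_1,P_1,V_2,P_2,R)\gets V_1=P_1$. 10. $sat\_cl5a(V_1,P_1,V_2,P_2,R)\gets sat\_cl3(R,V_2,P_2)$. 11. $sat(Cs,Vs)\gets sat\_cnf(Cs), tflist(Vs)$. 12. $tflist([\,])$. 13. $tflist([V|Vs])\gets tflist(Vs), tf(V)$. 14. $tf(\mathtt{true})$. 15. $tf(\mathtt{false})$. Let $\Pi_1,\Pi_2,\Pi_3,\Pi_4$ be the one-rule programs consisting of rule 7, rule 8, rule 9, rule 10, respectively, and $\Pi_5=P_3\setminus(\Pi_1\cup\Pi_2\cup\Pi_3\cup\Pi_4)$. A c-selection rule is a function assigning to a (non-empty) query an atom in the query and one of the programs $\emptyset,\Pi_1,\ldots,\Pi_5$. A pruned SLD-tree (csSLD-tree) via a c-selection rule is constructed as an SLD-tree, but for each node its children are constructed by resolving the selected atom using only the rules of the program selected in that node. An answer of such a tree with root $Q$ is an instance $Q\theta$ of the root, where $\theta$ is the computed answer substitution of a successful derivation that is a branch of the tree. Control: call a $sat\_cl5$-atom delayed if its first and third arguments are both variables. In a query consisting solely of delayed atoms the program $\emptyset$ is selected (so the query is a leaf). In any other non-empty query a non-delayed atom $A$ is selected, together with: $\Pi_1$ if $A$ is a $sat\_cl5$-atom whose first argument is not a variable; $\Pi_2$ if $A$ is a $sat\_cl5$-atom whose first argument is a variable; $\Pi_3$ if $A$ is a $sat\_cl5a$-atom whose first two arguments are unifiable; $\Pi_4$ if $A$ is any other $sat\_cl5a$-atom;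 $\Pi_5$ if $A$ has any other predicate symbol. Specification $S_3^0$. Let $L_1^0=\{[t_1-t'_1,\ldots,t_n-t'_n]\in\mathcal{HU}\mid n>0,\ t_i=t'_i\text{ for some }i\in\{1,\ldots,n\}\}$, $L_2^0=\{[s_1,\ldots,s_n]\mid n\ge0,\ s_1,\ldots,s_n\in L_1^0\}$, $TFL=\{[t_1,\ldots,t_n]\mid n\ge0,\ \text{each }t_i\in\{\mathtt{true},\mathtt{false}\}\}$. $S_3^0$ consists of the following ground atoms: $sat\_cl(s)$ for $s\in L_1^0$; $sat\_cnf(u)$ for $u\in L_2^0$; $t=t$ for $t\in\mathcal{HU}$; $sat\_cl3(s,v,p)$ for $[p-v|s]\in L_1^0$; $sat\_cl5(v_1,p_1,v_2,p_2,s)$ and $sat\_cl5a(v_1,p_1,v_2,p_2,s)$ for $[p_1-v_1,p_2-v_2|s]\in L_1^0$; $sat(u,t)$ for $u\in L_2^0$, $t\in TFL$; $tflist(t)$ for $t\in TFL$; $tf(\mathtt{true})$ and $tf(\mathtt{false})$. *)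

theory Defs
  imports Main
begin

section \<open>Alphabet, terms, atoms, queries\<close>

text \<open>
  The alphabet is arbitrary, subject to containing the symbols used in the program.
  Those symbols are dedicated constructors with the evident arities; all further function
  (predicate) symbols, if any, are given by a set \<open>F\<close> (\<open>Ps\<close>) of pairs of a name and an arity.
  Both sets may be empty.
\<close>

datatype 'f fsym = Nil_sym | Cons_sym | Minus_sym | True_sym | False_sym | Other_fsym 'f

datatype 'p psym =
    Sat | Sat_cnf | Sat_cl | Eq | Sat_cl3 | Sat_cl5 | Sat_cl5a | Tflist | Tf | Other_psym 'p

definition fun_alphabet :: "('f \<times> nat) set \<Rightarrow> ('f fsym \<times> nat) set" where
  "fun_alphabet F =
     {(Nil_sym, 0), (Cons_sym, 2), (Minus_sym, 2), (True_sym, 0), (False_sym, 0)}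
     \<union> {(Other_fsym f, n) | f n. (f, n) \<in> F}"

definition pred_alphabet :: "('p \<times> nat) set \<Rightarrow> ('p psym \<times> nat) set" where
  "pred_alphabet Ps =
     {(Sat, 2), (Sat_cnf, 1), (Sat_cl, 1), (Eq, 2), (Sat_cl3, 3), (Sat_cl5, 5), (Sat_cl5a, 5),
      (Tflist, 1), (Tf, 1)}
     \<union> {(Other_psym p, n) | p n. (p, n) \<in> Ps}"

type_synonym var = string

datatype 'f trm = Var var | Fn "'f fsym" "'f trm list"

datatype ('f, 'p) atom = Atom (pred: "'p psym") (args: "'f trm list")

type_synonym ('f, 'p) query = "('f, 'p) atom list"

datatype ('f, 'p) clause = Clause (head: "('f, 'p) atom") (body: "('f, 'p) atom list")
  (infix ":-" 45)

type_synonym ('f, 'p) program = "('f, 'p) clause set"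

primrec vars_trm :: "'f trm \<Rightarrow> var set" where
  "vars_trm (Var x) = {x}"
| "vars_trm (Fn f ts) = \<Union> (set (map vars_trm ts))"

definition vars_atom :: "('f, 'p) atom \<Rightarrow> var set" where
  "vars_atom A = (\<Union>t\<in>set (args A). vars_trm t)"

definition vars_query :: "('f, 'p) query \<Rightarrow> var set" where
  "vars_query G = (\<Union>A\<in>set G. vars_atom A)"

definition vars_clause :: "('f, 'p) clause \<Rightarrow> var set" where
  "vars_clause c = vars_atom (head c) \<union> vars_query (body c)"

fun wf_trm :: "('f \<times> nat) set \<Rightarrow> 'f trm \<Rightarrow> bool" where
  "wf_trm F (Var x) = True"
| "wf_trm F (Fn f ts) = ((f, length ts) \<in> fun_alphabet F \<and> (\<forall>t\<in>set ts. wf_trm F t))"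

definition wf_atom :: "('f \<times> nat) set \<Rightarrow> ('p \<times> nat) set \<Rightarrow> ('f, 'p) atom \<Rightarrow> bool" where
  "wf_atom F Ps A \<longleftrightarrow>
     (pred A, length (args A)) \<in> pred_alphabet Ps \<and> (\<forall>t\<in>set (args A). wf_trm F t)"

definition wf_query :: "('f \<times> nat) set \<Rightarrow> ('p \<times> nat) set \<Rightarrow> ('f, 'p) query \<Rightarrow> bool" where
  "wf_query F Ps G \<longleftrightarrow> (\<forall>A\<in>set G. wf_atom F Ps A)"

definition HU :: "('f \<times> nat) set \<Rightarrow> 'f trm set" where
  "HU F = {t. wf_trm F t \<and> vars_trm t = {}}"

abbreviation nil_trm :: "'f trm" where "nil_trm \<equiv> Fn Nil_sym []"
abbreviation cons_trm :: "'f trm \<Rightarrow> 'f trm \<Rightarrow> 'f trm" where "cons_trm h t \<equiv> Fn Cons_sym [h, t]"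
abbreviation minus_trm :: "'f trm \<Rightarrow> 'f trm \<Rightarrow> 'f trm" (infix "\<ominus>" 65) where
  "p \<ominus> v \<equiv> Fn Minus_sym [p, v]"
abbreviation true_trm :: "'f trm" where "true_trm \<equiv> Fn True_sym []"
abbreviation false_trm :: "'f trm" where "false_trm \<equiv> Fn False_sym []"

primrec list_trm :: "'f trm list \<Rightarrow> 'f trm" where
  "list_trm [] = nil_trm"
| "list_trm (t # ts) = cons_trm t (list_trm ts)"


section \<open>Substitutions and unification\<close>

type_synonym 'f subst = "var \<Rightarrow> 'f trm"

primrec subst_trm :: "'f subst \<Rightarrow> 'f trm \<Rightarrow> 'f trm" where
  "subst_trm \<sigma> (Var x) = \<sigma> x"
| "subst_trm \<sigma> (Fn f ts) = Fn f (map (subst_trm \<sigma>) ts)"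

definition subst_atom :: "'f subst \<Rightarrow> ('f, 'p) atom \<Rightarrow> ('f, 'p) atom" where
  "subst_atom \<sigma> A = Atom (pred A) (map (subst_trm \<sigma>) (args A))"

definition subst_query :: "'f subst \<Rightarrow> ('f, 'p) query \<Rightarrow> ('f, 'p) query" where
  "subst_query \<sigma> G = map (subst_atom \<sigma>) G"

definition subst_clause :: "'f subst \<Rightarrow> ('f, 'p) clause \<Rightarrow> ('f, 'p) clause" where
  "subst_clause \<sigma> c = (subst_atom \<sigma> (head c) :- subst_query \<sigma> (body c))"

definition subst_dom :: "'f subst \<Rightarrow> var set" where
  "subst_dom \<sigma> = {x. \<sigma> x \<noteq> Var x}"

definition subst_vars :: "'f subst \<Rightarrow> var set" where
  "subst_vars \<sigma> = subst_dom \<sigma> \<union> (\<Union>x\<in>subst_dom \<sigma>. vars_trm (\<sigma> x))"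

definition is_subst :: "('f \<times> nat) set \<Rightarrow> 'f subst \<Rightarrow> bool" where
  "is_subst F \<sigma> \<longleftrightarrow> finite (subst_dom \<sigma>) \<and> (\<forall>x. wf_trm F (\<sigma> x))"

text \<open>Composition in the order of logic programming: first \<open>\<theta>\<close>, then \<open>\<sigma>\<close>.\<close>

definition subst_comp :: "'f subst \<Rightarrow> 'f subst \<Rightarrow> 'f subst" (infixr "\<circ>\<^sub>s" 75) where
  "\<theta> \<circ>\<^sub>s \<sigma> = (\<lambda>x. subst_trm \<sigma> (\<theta> x))"

definition subst_restrict :: "var set \<Rightarrow> 'f subst \<Rightarrow> 'f subst" where
  "subst_restrict V \<sigma> = (\<lambda>x. if x \<in> V then \<sigma> x else Var x)"

definition unifiable_trms :: "('f \<times> nat) set \<Rightarrow> 'f trm \<Rightarrow> 'f trm \<Rightarrow> bool" where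
  "unifiable_trms F s t \<longleftrightarrow> (\<exists>\<sigma>. is_subst F \<sigma> \<and> subst_trm \<sigma> s = subst_trm \<sigma> t)"

definition is_unifier :: "('f \<times> nat) set \<Rightarrow> 'f subst \<Rightarrow> ('f, 'p) atom \<Rightarrow> ('f, 'p) atom \<Rightarrow> bool" where
  "is_unifier F \<sigma> A B \<longleftrightarrow> is_subst F \<sigma> \<and> subst_atom \<sigma> A = subst_atom \<sigma> B"

text \<open>An mgu is not required to be idempotent or relevant.\<close>

definition is_mgu :: "('f \<times> nat) set \<Rightarrow> 'f subst \<Rightarrow> ('f, 'p) atom \<Rightarrow> ('f, 'p) atom \<Rightarrow> bool" where
  "is_mgu F \<theta> A B \<longleftrightarrow>
     is_unifier F \<theta> A B \<and>
     (\<forall>\<sigma>. is_unifier F \<sigma> A B \<longrightarrow> (\<exists>\<gamma>. is_subst F \<gamma> \<and> \<sigma> = \<theta> \<circ>\<^sub>s \<gamma>))"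

definition variant :: "('f, 'p) clause \<Rightarrow> ('f, 'p) clause \<Rightarrow> bool" where
  "variant c c' \<longleftrightarrow>
     (\<exists>\<pi> :: var \<Rightarrow> var. bij \<pi> \<and> finite {x. \<pi> x \<noteq> x} \<and> c' = subst_clause (\<lambda>x. Var (\<pi> x)) c)"


section \<open>Pruned SLD-trees\<close>

text \<open>
  Each child of a node is indexed by the program rule that produced it, and the edge is
  decorated with the input clause (a variant of that rule) and the mgu.
  Trees may be infinite.
\<close>

codatatype ('f, 'p) sld_tree =
  Node (label: "('f, 'p) query")
       (children: "('f, 'p) clause \<Rightarrow> (('f, 'p) clause \<times> 'f subst \<times> ('f, 'p) sld_tree) option")

text \<open>
  A c-selection rule returns the position of the selected atom in the query (the query may
  contain several occurrences of an atom) and the selected program.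
\<close>

type_synonym ('f, 'p) c_selection = "('f, 'p) query \<Rightarrow> nat \<times> ('f, 'p) program"

definition c_selection_rule ::
  "('f \<times> nat) set \<Rightarrow> ('p \<times> nat) set \<Rightarrow> ('f, 'p) program set \<Rightarrow> ('f, 'p) c_selection \<Rightarrow> bool" where
  "c_selection_rule F Ps progs sel \<longleftrightarrow>
     (\<forall>G. G \<noteq> [] \<and> wf_query F Ps G \<longrightarrow>
        fst (sel G) < length G \<and> snd (sel G) \<in> insert {} progs)"

definition resolvent ::
  "('f, 'p) query \<Rightarrow> nat \<Rightarrow> ('f, 'p) clause \<Rightarrow> 'f subst \<Rightarrow> ('f, 'p) query" where
  "resolvent G i c \<theta> = subst_query \<theta> (take i G @ body c @ drop (Suc i) G)"

text \<open>
  The set \<open>V\<close> collects the variables of the root and of all input clauses and mgus on the path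
  from the root; input clauses are standardized apart from it.
\<close>

coinductive cs_sld_subtree ::
  "('f \<times> nat) set \<Rightarrow> ('f, 'p) c_selection \<Rightarrow> var set \<Rightarrow> ('f, 'p) sld_tree \<Rightarrow> bool"
  for F sel where
  empty: "cs_sld_subtree F sel V (Node [] (\<lambda>_. None))"
| resolve: "cs_sld_subtree F sel V (Node G ch)"
  if "G \<noteq> []"
  and "sel G = (i, P)"
  and "\<forall>c. ch c \<noteq> None \<longleftrightarrow>
         c \<in> P \<and>
         (\<exists>c' \<sigma>. variant c c' \<and> vars_clause c' \<inter> V = {} \<and> is_unifier F \<sigma> (G ! i) (head c'))"
  and "\<forall>c c' \<theta> T. ch c = Some (c', \<theta>, T) \<longrightarrow>
         variant c c' \<and> vars_clause c' \<inter> V = {} \<and>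
         is_mgu F \<theta> (G ! i) (head c') \<and>
         label T = resolvent G i c' \<theta> \<and>
         cs_sld_subtree F sel (V \<union> vars_clause c' \<union> subst_vars \<theta>) T"

definition cs_sld_tree ::
  "('f \<times> nat) set \<Rightarrow> ('f, 'p) c_selection \<Rightarrow> ('f, 'p) query \<Rightarrow> ('f, 'p) sld_tree \<Rightarrow> bool" where
  "cs_sld_tree F sel Q T \<longleftrightarrow> label T = Q \<and> cs_sld_subtree F sel (vars_query Q) T"

inductive successful_branch :: "('f, 'p) sld_tree \<Rightarrow> 'f subst list \<Rightarrow> bool" where
  "label T = [] \<Longrightarrow> successful_branch T []"
| "children T c = Some (c', \<theta>, T') \<Longrightarrow> successful_branch T' \<theta>s \<Longrightarrow> successful_branch T (\<theta> # \<theta>s)"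

definition computed_answer_subst :: "('f, 'p) query \<Rightarrow> 'f subst list \<Rightarrow> 'f subst" where
  "computed_answer_subst Q \<theta>s = subst_restrict (vars_query Q) (foldr (\<circ>\<^sub>s) \<theta>s Var)"

definition answers :: "('f, 'p) sld_tree \<Rightarrow> ('f, 'p) query set" where
  "answers T =
     {subst_query (computed_answer_subst (label T) \<theta>s) (label T) | \<theta>s. successful_branch T \<theta>s}"

text \<open>A ground query is identified with the conjunction of its atoms.\<close>

definition complete_tree :: "('f \<times> nat) set \<Rightarrow> ('f, 'p) sld_tree \<Rightarrow> ('f, 'p) atom set \<Rightarrow> bool" where
  "complete_tree F T S \<longleftrightarrow>
     (\<forall>\<theta>. is_subst F \<theta> \<and> vars_query (subst_query \<theta> (label T)) = {} \<and>
          set (subst_query \<theta> (label T)) \<subseteq> S \<longrightarrow>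
        (\<exists>G\<in>answers T. \<exists>\<sigma>. is_subst F \<sigma> \<and> subst_query \<theta> (label T) = subst_query \<sigma> G))"


section \<open>The program and its partition\<close>

abbreviation "sat u l \<equiv> Atom Sat [u, l]"
abbreviation "sat_cnf u \<equiv> Atom Sat_cnf [u]"
abbreviation "sat_cl s \<equiv> Atom Sat_cl [s]"
abbreviation "eq s t \<equiv> Atom Eq [s, t]"
abbreviation "sat_cl3 r v p \<equiv> Atom Sat_cl3 [r, v, p]"
abbreviation "sat_cl5 v1 p1 v2 p2 r \<equiv> Atom Sat_cl5 [v1, p1, v2, p2, r]"
abbreviation "sat_cl5a v1 p1 v2 p2 r \<equiv> Atom Sat_cl5a [v1, p1, v2, p2, r]"
abbreviation "tflist l \<equiv> Atom Tflist [l]"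
abbreviation "tf t \<equiv> Atom Tf [t]"

definition rule7 :: "('f, 'p) clause" where
  "rule7 = (sat_cl5 (Var ''V1'') (Var ''P1'') (Var ''V2'') (Var ''P2'') (Var ''R'') :-
              [sat_cl5a (Var ''V1'') (Var ''P1'') (Var ''V2'') (Var ''P2'') (Var ''R'')])"

definition rule8 :: "('f, 'p) clause" where
  "rule8 = (sat_cl5 (Var ''V1'') (Var ''P1'') (Var ''V2'') (Var ''P2'') (Var ''R'') :-
              [sat_cl5a (Var ''V2'') (Var ''P2'') (Var ''V1'') (Var ''P1'') (Var ''R'')])"

definition rule9 :: "('f, 'p) clause" where
  "rule9 = (sat_cl5a (Var ''V1'') (Var ''P1'') (Var ''V2'') (Var ''P2'') (Var ''R'') :-
              [eq (Var ''V1'') (Var ''P1'')])"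

definition rule10 :: "('f, 'p) clause" where
  "rule10 = (sat_cl5a (Var ''V1'') (Var ''P1'') (Var ''V2'') (Var ''P2'') (Var ''R'') :-
               [sat_cl3 (Var ''R'') (Var ''V2'') (Var ''P2'')])"

definition P3 :: "('f, 'p) program" where
  "P3 = {
     sat_cnf nil_trm :- [],
     sat_cnf (cons_trm (Var ''C'') (Var ''Cs'')) :- [sat_cl (Var ''C''), sat_cnf (Var ''Cs'')],
     sat_cl (cons_trm (Var ''P'' \<ominus> Var ''V'') (Var ''R'')) :-
       [sat_cl3 (Var ''R'') (Var ''V'') (Var ''P'')],
     eq (Var ''X'') (Var ''X'') :- [],
     sat_cl3 nil_trm (Var ''V'') (Var ''P'') :- [eq (Var ''V'') (Var ''P'')],
     sat_cl3 (cons_trm (Var ''P2'' \<ominus> Var ''V2'') (Var ''R'')) (Var ''V1'') (Var ''P1'') :-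
       [sat_cl5 (Var ''V1'') (Var ''P1'') (Var ''V2'') (Var ''P2'') (Var ''R'')],
     rule7, rule8, rule9, rule10,
     sat (Var ''Cs'') (Var ''Vs'') :- [sat_cnf (Var ''Cs''), tflist (Var ''Vs'')],
     tflist nil_trm :- [],
     tflist (cons_trm (Var ''V'') (Var ''Vs'')) :- [tflist (Var ''Vs''), tf (Var ''V'')],
     tf true_trm :- [],
     tf false_trm :- []}"

definition Pi1 :: "('f, 'p) program" where "Pi1 = {rule7}"
definition Pi2 :: "('f, 'p) program" where "Pi2 = {rule8}"
definition Pi3 :: "('f, 'p) program" where "Pi3 = {rule9}"
definition Pi4 :: "('f, 'p) program" where "Pi4 = {rule10}"
definition Pi5 :: "('f, 'p) program" where "Pi5 = P3 - (Pi1 \<union> Pi2 \<union> Pi3 \<union> Pi4)"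

lemma partition_P3:
  "P3 = Pi1 \<union> Pi2 \<union> Pi3 \<union> Pi4 \<union> Pi5"
  "pairwise disjnt {Pi1, Pi2, Pi3, Pi4, Pi5}"
  by (auto simp: P3_def Pi1_def Pi2_def Pi3_def Pi4_def Pi5_def
      pairwise_def disjnt_def rule7_def rule8_def rule9_def rule10_def)


section \<open>The control\<close>

definition delayed :: "('f, 'p) atom \<Rightarrow> bool" where
  "delayed A \<longleftrightarrow> (\<exists>x p1 y p2 r. A = sat_cl5 (Var x) p1 (Var y) p2 r)"

definition control_program :: "('f \<times> nat) set \<Rightarrow> ('f, 'p) atom \<Rightarrow> ('f, 'p) program" where
  "control_program F A =
     (if pred A = Sat_cl5 then (if \<exists>x. args A ! 0 = Var x then Pi2 else Pi1)
      else if pred A = Sat_cl5a then (if unifiable_trms F (args A ! 0) (args A ! 1) then Pi3 else Pi4)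
      else Pi5)"

definition implements_control ::
  "('f \<times> nat) set \<Rightarrow> ('p \<times> nat) set \<Rightarrow> ('f, 'p) c_selection \<Rightarrow> bool" where
  "implements_control F Ps sel \<longleftrightarrow>
     (\<forall>G i P. G \<noteq> [] \<and> wf_query F Ps G \<and> sel G = (i, P) \<longrightarrow>
        (if \<forall>A\<in>set G. delayed A then P = {}
         else \<not> delayed (G ! i) \<and> P = control_program F (G ! i)))"


section \<open>The specification\<close>

definition L1 :: "('f \<times> nat) set \<Rightarrow> 'f trm set" where
  "L1 F = {list_trm (map (\<lambda>(t, t'). t \<ominus> t') ps) | ps. ps \<noteq> [] \<and> (\<exists>(t, t')\<in>set ps. t = t')} \<inter> HU F"

definition L2 :: "('f \<times> nat) set \<Rightarrow> 'f trm set" where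
  "L2 F = {list_trm ss | ss. set ss \<subseteq> L1 F}"

definition TFL :: "'f trm set" where
  "TFL = {list_trm ts | ts. set ts \<subseteq> {true_trm, false_trm}}"

inductive_set S30 :: "('f \<times> nat) set \<Rightarrow> ('f, 'p) atom set" for F where
  "s \<in> L1 F \<Longrightarrow> sat_cl s \<in> S30 F"
| "u \<in> L2 F \<Longrightarrow> sat_cnf u \<in> S30 F"
| "t \<in> HU F \<Longrightarrow> eq t t \<in> S30 F"
| "cons_trm (p \<ominus> v) s \<in> L1 F \<Longrightarrow> sat_cl3 s v p \<in> S30 F"
| "cons_trm (p1 \<ominus> v1) (cons_trm (p2 \<ominus> v2) s) \<in> L1 F \<Longrightarrow> sat_cl5 v1 p1 v2 p2 s \<in> S30 F"
| "cons_trm (p1 \<ominus> v1) (cons_trm (p2 \<ominus> v2) s) \<in> L1 F \<Longrightarrow> sat_cl5a v1 p1 v2 p2 s \<in> S30 F"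
| "u \<in> L2 F \<Longrightarrow> t \<in> TFL \<Longrightarrow> sat u t \<in> S30 F"
| "t \<in> TFL \<Longrightarrow> tflist t \<in> S30 F"
| "tf true_trm \<in> S30 F"
| "tf false_trm \<in> S30 F"


section \<open>Representation of CNF formulae\<close>

datatype 'x literal = Pos 'x | Neg 'x

text \<open>A clause is a list of literals; a formula in CNF is a list of clauses.\<close>

type_synonym 'x cnf = "'x literal list list"

primrec lit_var :: "'x literal \<Rightarrow> 'x" where
  "lit_var (Pos x) = x"
| "lit_var (Neg x) = x"

definition cnf_vars :: "'x cnf \<Rightarrow> 'x set" where
  "cnf_vars \<phi> = (\<Union>c\<in>set \<phi>. lit_var ` set c)"

text \<open>The map \<open>\<rho>\<close> tells which logical variable represents a given propositional variable.\<close>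

primrec rep_lit :: "('x \<Rightarrow> var) \<Rightarrow> 'x literal \<Rightarrow> 'f trm" where
  "rep_lit \<rho> (Pos x) = true_trm \<ominus> Var (\<rho> x)"
| "rep_lit \<rho> (Neg x) = false_trm \<ominus> Var (\<rho> x)"

definition rep_cnf :: "('x \<Rightarrow> var) \<Rightarrow> 'x cnf \<Rightarrow> 'f trm" where
  "rep_cnf \<rho> \<phi> = list_trm (map (\<lambda>c. list_trm (map (rep_lit \<rho>) c)) \<phi>)"

end

(*
  Lift a refutation of the ground instance Q\<eta> to a branch of T.  Resolving a ground atom of S30
  with a suitable rule keeps all atoms in S30 and decreases a weight, and standardizing apart plus
  most general unifiers lift each ground step, provided the control selects that rule.

  This holds because of two invariants.  Every V-argument is a variable or a truth value, and a
  sat_cl5a-atom is only reached with a truth value as its first argument; so V1 and P1 are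
  unifiable iff they are equal, and whenever rule 9 is selected it is sound to drop rule 10 (and
  conversely).  The choice between rules 7 and 8 is irrelevant since L1 is closed under swapping
  literals.  Secondly, each variable of a node occurs in a remaining sat-, tflist- or tf-atom, so no
  node consists of delayed atoms only.
*)
theory Submission
  imports Defs
begin

section \<open>Substitutions\<close>

lemma vars_subst_trm: "vars_trm (subst_trm \<sigma> t) = (\<Union>x\<in>vars_trm t. vars_trm (\<sigma> x))"
  by (induction t) auto

lemma vars_subst_atom: "vars_atom (subst_atom \<sigma> A) = (\<Union>x\<in>vars_atom A. vars_trm (\<sigma> x))"
  by (auto simp: vars_atom_def subst_atom_def vars_subst_trm)

lemma subst_trm_cong: "(\<And>x. x \<in> vars_trm t \<Longrightarrow> \<sigma> x = \<tau> x) \<Longrightarrow> subst_trm \<sigma> t = subst_trm \<tau> t"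
  by (induction t) auto

lemma subst_atom_cong: "(\<And>x. x \<in> vars_atom A \<Longrightarrow> \<sigma> x = \<tau> x) \<Longrightarrow> subst_atom \<sigma> A = subst_atom \<tau> A"
  by (auto simp: vars_atom_def subst_atom_def intro!: subst_trm_cong)

lemma subst_query_cong: "(\<And>x. x \<in> vars_query G \<Longrightarrow> \<sigma> x = \<tau> x) \<Longrightarrow> subst_query \<sigma> G = subst_query \<tau> G"
  by (auto simp: vars_query_def subst_query_def intro!: subst_atom_cong)

lemma subst_trm_comp: "subst_trm (\<sigma> \<circ>\<^sub>s \<tau>) t = subst_trm \<tau> (subst_trm \<sigma> t)"
  by (induction t) (auto simp: subst_comp_def)

lemma subst_atom_comp: "subst_atom (\<sigma> \<circ>\<^sub>s \<tau>) A = subst_atom \<tau> (subst_atom \<sigma> A)"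
  by (simp add: subst_atom_def subst_trm_comp)

lemma subst_query_comp: "subst_query (\<sigma> \<circ>\<^sub>s \<tau>) G = subst_query \<tau> (subst_query \<sigma> G)"
  by (simp add: subst_query_def subst_atom_comp)

lemma finite_vars_trm: "finite (vars_trm t)"
  by (induction t) auto

lemma finite_vars_atom: "finite (vars_atom A)"
  by (auto simp: vars_atom_def finite_vars_trm)

lemma finite_vars_query: "finite (vars_query G)"
  by (auto simp: vars_query_def finite_vars_atom)

lemma finite_vars_clause: "finite (vars_clause c)"
  by (auto simp: vars_clause_def finite_vars_query finite_vars_atom)

lemma finite_subst_vars: "is_subst F \<theta> \<Longrightarrow> finite (subst_vars \<theta>)"
  by (auto simp: is_subst_def subst_vars_def finite_vars_trm)

text \<open>An mgu may bring in new variables; these lie in \<open>subst_vars\<close>, while a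
  variable outside the domain is its own image, hence \<open>insert x\<close>.\<close>

lemma vars_trm_subset_subst_vars: "vars_trm (\<theta> x) \<subseteq> insert x (subst_vars \<theta>)"
  by (cases "\<theta> x = Var x") (auto simp: subst_vars_def subst_dom_def)

lemma subst_query_append [simp]:
  "subst_query \<sigma> (G @ H) = subst_query \<sigma> G @ subst_query \<sigma> H"
  by (simp add: subst_query_def)

text \<open>A renaming has to be a bijection of all variables with finite support. Exchanging the
  variables of \<open>c\<close> with an equally large fresh set achieves this, the swap being its
  own inverse.\<close>

lemma ex_variant_disjoint:
  assumes "finite V"
  shows "\<exists>c'. variant c c' \<and> vars_clause c' \<inter> V = {}"
proof -
  let ?A = "vars_clause c"
  have finA: "finite ?A" by (rule finite_vars_clause)
  \<comment> \<open>There are infinitely many strings, so \<open>W\<close> can avoid both the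
    forbidden set and the rule's own variables.\<close>
  obtain W :: "var set" where W: "finite W" "card W = card ?A" "W \<subseteq> - (V \<union> ?A)"
    using infinite_arbitrarily_large[of "- (V \<union> ?A)" "card ?A"] finA assms
      finite_compl[of "V \<union> ?A"] infinite_UNIV_listI[where 'a = char] by auto
  then obtain f where f: "bij_betw f ?A W"
    using finite_same_card_bij[OF finA W(1)] by auto
  define \<pi> where "\<pi> x = (if x \<in> ?A then f x else if x \<in> W then inv_into ?A f x else x)" for x
  have fW: "f x \<in> W" if "x \<in> ?A" for x using f that by (auto simp: bij_betw_def)
  have gA: "inv_into ?A f x \<in> ?A" if "x \<in> W" for x using f that
    by (metis bij_betw_imp_surj_on inv_into_into)
  have "\<pi> (\<pi> x) = x" for x
    using W(3) f fW[of x] gA[of x]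
    by (auto simp: \<pi>_def bij_betw_inv_into_left bij_betw_inv_into_right)
  then have "bij \<pi>" by (metis bij_iff)
  moreover have "finite {x. \<pi> x \<noteq> x}"
    by (rule finite_subset[of _ "?A \<union> W"]) (use finA W in \<open>auto simp: \<pi>_def\<close>)
  ultimately have "variant c (subst_clause (\<lambda>x. Var (\<pi> x)) c)"
    unfolding variant_def by blast
  moreover have "vars_clause (subst_clause (\<lambda>x. Var (\<pi> x)) c) = \<pi> ` ?A"
    by (auto simp: vars_clause_def subst_clause_def vars_query_def subst_query_def vars_subst_atom)
  moreover have "\<pi> ` ?A \<inter> V = {}" using W(3) fW by (auto simp: \<pi>_def)
  ultimately show ?thesis by metis
qed

text \<open>As \<open>c'\<close> shares no variable with \<open>V\<close>, a rule instance on the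
  variables of \<open>c'\<close> and \<eta> elsewhere can be glued into one substitution.\<close>

lemma variant_unifier:
  assumes var: "variant c c'" and disj: "vars_clause c' \<inter> V = {}"
    and \<eta>: "is_subst F \<eta>" and \<tau>: "\<And>x. wf_trm F (\<tau> x)"
  obtains \<mu> where "is_subst F \<mu>" "\<forall>x\<in>V. \<mu> x = \<eta> x"
    "subst_atom \<mu> (head c') = subst_atom \<tau> (head c)"
    "subst_query \<mu> (body c') = subst_query \<tau> (body c)"
proof -
  from var obtain \<pi> where \<pi>: "bij \<pi>" "c' = subst_clause (\<lambda>x. Var (\<pi> x)) c"
    unfolding variant_def by blast
  \<comment> \<open>\<open>inv \<pi>\<close> undoes the renaming, so the variant receives the
    instance that \<tau> gives to \<open>c\<close>.\<close>
  define \<mu> where "\<mu> x = (if x \<in> vars_clause c' then \<tau> (inv \<pi> x) else \<eta> x)" for x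
  have "subst_dom \<mu> \<subseteq> vars_clause c' \<union> subst_dom \<eta>" by (auto simp: subst_dom_def \<mu>_def)
  then have "finite (subst_dom \<mu>)"
    using \<eta> finite_vars_clause[of c'] by (meson finite_Un finite_subset is_subst_def)
  then have 1: "is_subst F \<mu>" using \<eta> \<tau> by (auto simp: is_subst_def \<mu>_def)
  have 2: "((\<lambda>x. Var (\<pi> x)) \<circ>\<^sub>s (\<lambda>x. \<tau> (inv \<pi> x))) = \<tau>"
    using \<pi>(1) by (auto simp: subst_comp_def bij_is_inj)
  have 3: "subst_atom \<mu> (head c') = subst_atom (\<lambda>x. \<tau> (inv \<pi> x)) (head c')"
    "subst_query \<mu> (body c') = subst_query (\<lambda>x. \<tau> (inv \<pi> x)) (body c')"
    by (auto intro!: subst_atom_cong subst_query_cong simp: \<mu>_def vars_clause_def)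
  show thesis
    by (rule that[OF 1])
      (use disj 2 3 \<pi>(2) in \<open>auto simp: \<mu>_def subst_clause_def simp flip: subst_atom_comp subst_query_comp\<close>)
qed


section \<open>The shape of queries in the tree\<close>

definition truth_val :: "'f trm \<Rightarrow> bool" where
  "truth_val t \<longleftrightarrow> t = true_trm \<or> t = false_trm"

definition simple :: "'f trm \<Rightarrow> bool" where
  "simple t \<longleftrightarrow> (\<exists>x. t = Var x) \<or> truth_val t"

inductive list_of :: "('f trm \<Rightarrow> bool) \<Rightarrow> 'f trm \<Rightarrow> bool" for P where
  "list_of P nil_trm"
| "P h \<Longrightarrow> list_of P t \<Longrightarrow> list_of P (cons_trm h t)"

definition lit :: "'f trm \<Rightarrow> bool" where
  "lit t \<longleftrightarrow> (\<exists>p v. t = p \<ominus> v \<and> truth_val p \<and> simple v)"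

text \<open>
  A \<open>sat_cl5a\<close>-atom only arises when its first argument is already bound to a truth value, so that
  the test for unifiability in the control coincides with equality.
\<close>

inductive shape :: "('f, 'p) atom \<Rightarrow> bool" where
  "list_of (list_of lit) u \<Longrightarrow> list_of simple l \<Longrightarrow> shape (sat u l)"
| "list_of (list_of lit) u \<Longrightarrow> shape (sat_cnf u)"
| "list_of lit s \<Longrightarrow> shape (sat_cl s)"
| "simple v \<Longrightarrow> truth_val p \<Longrightarrow> shape (eq v p)"
| "list_of lit r \<Longrightarrow> simple v \<Longrightarrow> truth_val p \<Longrightarrow> shape (sat_cl3 r v p)"
| "simple v1 \<Longrightarrow> truth_val p1 \<Longrightarrow> simple v2 \<Longrightarrow> truth_val p2 \<Longrightarrow> list_of lit r
    \<Longrightarrow> shape (sat_cl5 v1 p1 v2 p2 r)"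
| "truth_val v1 \<Longrightarrow> truth_val p1 \<Longrightarrow> simple v2 \<Longrightarrow> truth_val p2 \<Longrightarrow> list_of lit r
    \<Longrightarrow> shape (sat_cl5a v1 p1 v2 p2 r)"
| "list_of simple l \<Longrightarrow> shape (tflist l)"
| "simple v \<Longrightarrow> shape (tf v)"

inductive_simps list_of_simps [simp]:
  "list_of P nil_trm" "list_of P (cons_trm h t)"

inductive_simps shape_simps [simp]:
  "shape (sat u l)" "shape (sat_cnf u)" "shape (sat_cl s)" "shape (eq v p)"
  "shape (sat_cl3 r v p)" "shape (sat_cl5 v1 p1 v2 p2 r)" "shape (sat_cl5a v1 p1 v2 p2 r)"
  "shape (tflist l)" "shape (tf v)"

lemma lit_minus [simp]: "lit (p \<ominus> v) \<longleftrightarrow> truth_val p \<and> simple v"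
  by (auto simp: lit_def)

lemma truth_val_subst: "truth_val t \<Longrightarrow> subst_trm \<sigma> t = t"
  by (auto simp: truth_val_def)

lemma truth_val_imp_simple: "truth_val t \<Longrightarrow> simple t"
  by (simp add: simple_def)

lemma list_of_subst:
  assumes "list_of P t" "vars_trm t \<subseteq> X"
    and "\<And>h. P h \<Longrightarrow> vars_trm h \<subseteq> X \<Longrightarrow> P' (subst_trm \<theta> h)"
  shows "list_of P' (subst_trm \<theta> t)"
  using assms(1,2) by induction (auto simp: assms(3))

text \<open>A variable argument becomes simple and a truth value is left alone, so every kind of
  argument survives.\<close>

lemma shape_subst:
  assumes "shape A" and X: "\<And>x. x \<in> vars_atom A \<Longrightarrow> simple (\<theta> x)"
  shows "shape (subst_atom \<theta> A)"
proof -
  let ?X = "vars_atom A"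
  have v: "simple (subst_trm \<theta> t)" if "simple t" "vars_trm t \<subseteq> ?X" for t
  proof (cases "\<exists>x. t = Var x")
    case True
    then show ?thesis using that X by auto
  next
    case False
    then show ?thesis using that by (auto simp: simple_def truth_val_subst)
  qed
  have l: "lit (subst_trm \<theta> t)" if "lit t" "vars_trm t \<subseteq> ?X" for t
    using that v by (auto simp: lit_def truth_val_subst)
  have c: "list_of lit (subst_trm \<theta> t)" if "list_of lit t" "vars_trm t \<subseteq> ?X" for t
    using that l by (rule list_of_subst)
  have f: "list_of (list_of lit) (subst_trm \<theta> t)" if "list_of (list_of lit) t" "vars_trm t \<subseteq> ?X" for t
    using that c by (rule list_of_subst)
  have s: "list_of simple (subst_trm \<theta> t)" if "list_of simple t" "vars_trm t \<subseteq> ?X" for t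
    using that v by (rule list_of_subst)
  have a: "vars_trm t \<subseteq> ?X" if "t \<in> set (args A)" for t
    using that by (auto simp: vars_atom_def)
  from \<open>shape A\<close> show ?thesis
    by cases (use a in \<open>simp_all add: subst_atom_def v c f s truth_val_subst\<close>)
qed

lemma wf_list_of:
  assumes "list_of P t" "\<And>h. P h \<Longrightarrow> wf_trm F h"
  shows "wf_trm F t"
  using assms(1) by induction (auto simp: fun_alphabet_def assms(2))

text \<open>Selection rules are constrained only on well-formed queries; this makes the constraints
  available at every node satisfying the invariant.\<close>

lemma shape_wf:
  assumes "shape A"
  shows "wf_atom F Ps A"
proof -
  have v: "truth_val t \<Longrightarrow> wf_trm F t" "simple t \<Longrightarrow> wf_trm F t" for t
    by (auto simp: truth_val_def simple_def fun_alphabet_def)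
  have l: "lit t \<Longrightarrow> wf_trm F t" for t
    by (auto simp: lit_def fun_alphabet_def v)
  have c: "list_of lit t \<Longrightarrow> wf_trm F t" "list_of (list_of lit) t \<Longrightarrow> wf_trm F t"
    "list_of simple t \<Longrightarrow> wf_trm F t" for t
    using l v by (blast intro: wf_list_of)+
  from assms show ?thesis
    by cases (auto simp: wf_atom_def pred_alphabet_def v c)
qed

text \<open>Only rules 7 and 8 demand more than the shape of the head gives: the first argument of
  the resulting \<open>sat_cl5a\<close>-atom must be a truth value. The choice that the control
  makes between them secures this.\<close>

lemma shape_body:
  assumes "c \<in> control_program F A" "shape A" "\<not> delayed A"
    and "shape (subst_atom \<theta> A)" "subst_atom \<theta> A = subst_atom \<sigma> (head c)"
  shows "\<forall>B\<in>set (body c). shape (subst_atom \<sigma> B)"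
proof (cases "pred A = Sat_cl5")
  case True
  from \<open>shape A\<close> True obtain v1 p1 v2 p2 r
    where A: "A = sat_cl5 v1 p1 v2 p2 r" "simple v1" "simple v2" by cases auto
  show ?thesis
  proof (cases "\<exists>x. v1 = Var x")
    case True
    \<comment> \<open>The first argument is a variable and the atom is not delayed, so the third is
      a truth value; rule 8 moves it to the front.\<close>
    then have "truth_val v2" using A assms(3) by (auto simp: delayed_def simple_def)
    then show ?thesis using True assms A
      by (auto simp: control_program_def Pi2_def rule8_def subst_atom_def truth_val_subst)
  next
    case False
    then have "truth_val v1" using A assms(3) by (auto simp: simple_def)
    then show ?thesis using False assms A
      by (auto simp: control_program_def Pi1_def rule7_def subst_atom_def truth_val_subst)
  qed
next
  case False
  then have "c \<in> P3 - {rule7, rule8}"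
    using assms(1) by (auto simp: control_program_def P3_def Pi1_def Pi2_def Pi3_def Pi4_def Pi5_def
        rule7_def rule8_def rule9_def rule10_def split: if_splits)
  moreover have "shape (subst_atom \<sigma> (head c))" using assms(4,5) by simp
  ultimately show ?thesis
    by (auto simp: P3_def rule9_def rule10_def subst_atom_def truth_val_imp_simple)
qed

section \<open>Coverage of variables and the invariant along a branch\<close>

text \<open>
  The arguments holding the variables that the remaining \<open>tf\<close>-calls are going to bind.  Since they
  cover all variables of a query, no query consists of delayed atoms only.
\<close>

definition cov_args :: "('f, 'p) atom \<Rightarrow> 'f trm list" where
  "cov_args A = (if pred A = Sat then drop 1 (args A)
     else if pred A \<in> {Tflist, Tf} then args A else [])"

definition cov :: "('f, 'p) atom \<Rightarrow> var set" where
  "cov A = (\<Union>t\<in>set (cov_args A). vars_trm t)"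

lemma cov_subst: "cov (subst_atom \<sigma> A) = (\<Union>x\<in>cov A. vars_trm (\<sigma> x))"
proof -
  have "cov_args (subst_atom \<sigma> A) = map (subst_trm \<sigma>) (cov_args A)"
    by (simp add: cov_args_def subst_atom_def drop_map)
  then show ?thesis by (auto simp: cov_def vars_subst_trm)
qed

text \<open>Rules have no local body variables, so the variables of a resolvent all stem from terms
  substituted for variables of the node.\<close>

lemma P3_vars_body: "c \<in> P3 \<Longrightarrow> vars_query (body c) \<subseteq> vars_atom (head c)"
  by (auto simp: P3_def rule7_def rule8_def rule9_def rule10_def vars_query_def vars_atom_def)

text \<open>Covered variables are handed on from \<open>sat\<close> to \<open>tflist\<close> and
  from there to \<open>tf\<close>; the unit rules ending this chain have ground heads, so coverage
  is never lost.\<close>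

lemma P3_cov_head: "c \<in> P3 \<Longrightarrow> cov (head c) \<subseteq> (\<Union>B\<in>set (body c). cov B)"
  by (auto simp: P3_def rule7_def rule8_def rule9_def rule10_def cov_def cov_args_def)

lemma control_program_subset_P3: "control_program F A \<subseteq> P3"
  using partition_P3(1) by (auto simp: control_program_def)

text \<open>The last conjunct also restrains the mgu: a term having a truth value as an instance is
  itself a variable or a truth value.\<close>

definition invar :: "('f, 'p) query \<Rightarrow> 'f subst \<Rightarrow> bool" where
  "invar G \<eta> \<longleftrightarrow> (\<forall>A\<in>set G. shape A) \<and> vars_query G \<subseteq> (\<Union>A\<in>set G. cov A) \<and>
     (\<forall>x\<in>vars_query G. truth_val (\<eta> x))"

text \<open>A delayed atom has variables but covers none, so a nonempty query of delayed atoms would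
  leave them uncovered.\<close>

lemma invar_imp_not_delayed:
  assumes "invar G \<eta>" "G \<noteq> []"
  shows "\<exists>A\<in>set G. \<not> delayed A"
proof (rule ccontr)
  assume "\<not> ?thesis"
  then have d: "\<forall>A\<in>set G. delayed A" by blast
  then have "(\<Union>A\<in>set G. cov A) = {}"
    by (fastforce simp: delayed_def cov_def cov_args_def)
  then have "vars_query G = {}" using assms(1) by (auto simp: invar_def)
  moreover have "\<exists>A. A \<in> set G" using assms(2) by (cases G) auto
  ultimately show False using d by (fastforce simp: vars_query_def delayed_def vars_atom_def)
qed

text \<open>\<gamma> is what remains of \<eta> after factoring it through the mgu, and takes over
  its role at the child.\<close>

lemma resolvent_invar:
  assumes inv: "invar G \<eta>" and i: "i < length G" and nd: "\<not> delayed (G ! i)"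
    and c: "c \<in> control_program F (G ! i)" and var: "variant c c'"
    and unif: "subst_atom \<theta> (G ! i) = subst_atom \<theta> (head c')"
    and \<gamma>: "\<And>x. x \<in> vars_query G \<Longrightarrow> \<eta> x = subst_trm \<gamma> (\<theta> x)"
  shows "invar (resolvent G i c' \<theta>) \<gamma>"
proof -
  let ?A = "G ! i"
  from var obtain \<pi> where \<pi>: "c' = subst_clause (\<lambda>x. Var (\<pi> x)) c"
    unfolding variant_def by blast
  \<comment> \<open>Renaming followed by the mgu: through \<sigma>, facts about the rule
    \<open>c\<close> itself apply to its variant.\<close>
  define \<sigma> where "\<sigma> = (\<lambda>x. Var (\<pi> x)) \<circ>\<^sub>s \<theta>"
  have hd: "subst_atom \<theta> (head c') = subst_atom \<sigma> (head c)"
    and bd: "subst_query \<theta> (body c') = subst_query \<sigma> (body c)"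
    by (simp_all add: \<pi> \<sigma>_def subst_clause_def subst_atom_comp subst_query_comp)
  have AG: "?A \<in> set G" using i by simp
  have st: "simple (\<theta> x)" and tv: "\<forall>y\<in>vars_trm (\<theta> x). truth_val (\<gamma> y)"
    if "x \<in> vars_query G" for x
  proof -
    have "truth_val (subst_trm \<gamma> (\<theta> x))" using inv \<gamma> that by (auto simp: invar_def)
    then show "simple (\<theta> x)" "\<forall>y\<in>vars_trm (\<theta> x). truth_val (\<gamma> y)"
      by (cases "\<theta> x"; auto simp: simple_def truth_val_def)+
  qed
  have shG: "shape (subst_atom \<theta> B)" if "B \<in> set G" for B
    using that inv st by (auto simp: invar_def vars_query_def intro!: shape_subst)
  have shb: "\<forall>B\<in>set (body c). shape (subst_atom \<sigma> B)"
    by (rule shape_body[OF c _ nd shG[OF AG]]) (use inv AG unif hd in \<open>auto simp: invar_def\<close>)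
  have c3: "c \<in> P3" using c control_program_subset_P3 by blast
  have G: "set G = insert ?A (set (take i G) \<union> set (drop (Suc i) G))"
    by (metis id_take_nth_drop[OF i] set_append list.simps(15) Un_insert_right)
  let ?R = "set (resolvent G i c' \<theta>)"
  have mem: "?R = subst_atom \<theta> ` (set (take i G) \<union> set (drop (Suc i) G)) \<union> subst_atom \<sigma> ` set (body c)"
    using bd by (auto simp: resolvent_def subst_query_def)
  \<comment> \<open>The selected atom may occur repeatedly; comparing atoms rather than positions
    suffices, since the body covers whatever \<open>?A\<close> covers.\<close>
  have mem1: "subst_atom \<theta> B \<in> ?R" if "B \<in> set G" "B \<noteq> ?A" for B
    using that mem unfolding G by auto
  have mem2: "subst_atom \<sigma> B \<in> ?R" if "B \<in> set (body c)" for B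
    using that mem by auto
  have memE: "(\<exists>B\<in>set G. C = subst_atom \<theta> B) \<or> (\<exists>B\<in>set (body c). C = subst_atom \<sigma> B)"
    if "C \<in> ?R" for C
    using that unfolding mem G by auto
  have A: "subst_atom \<theta> ?A = subst_atom \<sigma> (head c)" using unif hd by simp
  have "vars_query (subst_query \<sigma> (body c)) \<subseteq> vars_atom (subst_atom \<sigma> (head c))"
    using P3_vars_body[OF c3] by (fastforce simp: vars_query_def subst_query_def vars_subst_atom)
  then have vb: "\<forall>B\<in>set (body c). vars_atom (subst_atom \<sigma> B) \<subseteq> vars_atom (subst_atom \<theta> ?A)"
    unfolding A by (auto simp: vars_query_def subst_query_def)
  have vG: "\<forall>y\<in>vars_query (resolvent G i c' \<theta>). \<exists>x\<in>vars_query G. y \<in> vars_trm (\<theta> x)"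
  proof
    fix y assume "y \<in> vars_query (resolvent G i c' \<theta>)"
    then obtain B where "B \<in> set (resolvent G i c' \<theta>)" "y \<in> vars_atom B"
      by (auto simp: vars_query_def)
    then obtain C where "C \<in> set G" "y \<in> vars_atom (subst_atom \<theta> C)"
      using vb AG memE by (metis subsetD)
    then show "\<exists>x\<in>vars_query G. y \<in> vars_trm (\<theta> x)"
      by (auto simp: vars_subst_atom vars_query_def)
  qed
  have cv: "\<exists>B\<in>set (resolvent G i c' \<theta>). y \<in> cov B"
    if x: "x \<in> vars_query G" and y: "y \<in> vars_trm (\<theta> x)" for x y
  proof -
    from inv x obtain C where C: "C \<in> set G" "x \<in> cov C" by (auto simp: invar_def)
    then have yC: "y \<in> cov (subst_atom \<theta> C)" using y by (auto simp: cov_subst)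
    show ?thesis
    proof (cases "C = ?A")
      case True
      then have "y \<in> cov (subst_atom \<sigma> (head c))" using yC A by simp
      then obtain B where "B \<in> set (body c)" "y \<in> cov (subst_atom \<sigma> B)"
        using P3_cov_head[OF c3] by (fastforce simp: cov_subst)
      then show ?thesis using mem2 by blast
    next
      case False
      then show ?thesis using C(1) yC mem1 by blast
    qed
  qed
  show ?thesis
    unfolding invar_def
  proof (intro conjI ballI subsetI)
    fix C assume "C \<in> ?R"
    then show "shape C" using memE shb shG by blast
  next
    fix y assume "y \<in> vars_query (resolvent G i c' \<theta>)"
    then obtain x where x: "x \<in> vars_query G" "y \<in> vars_trm (\<theta> x)" using vG by blast
    from cv[OF x] show "y \<in> (\<Union>B\<in>?R. cov B)" by simp
    from tv[OF x(1)] x(2) show "truth_val (\<gamma> y)" by simp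
  qed
qed


section \<open>Resolving atoms of the specification\<close>

lemma HU_Fn: "Fn f ts \<in> HU F \<longleftrightarrow> (f, length ts) \<in> fun_alphabet F \<and> (\<forall>t\<in>set ts. t \<in> HU F)"
  by (auto simp: HU_def)

lemma HU_cons [simp]: "cons_trm h t \<in> HU F \<longleftrightarrow> h \<in> HU F \<and> t \<in> HU F"
  by (auto simp: HU_Fn fun_alphabet_def)

lemma HU_minus [simp]: "h \<ominus> t \<in> HU F \<longleftrightarrow> h \<in> HU F \<and> t \<in> HU F"
  by (auto simp: HU_Fn fun_alphabet_def)

lemma HU_const [simp]: "nil_trm \<in> HU F" "true_trm \<in> HU F" "false_trm \<in> HU F"
  by (auto simp: HU_Fn fun_alphabet_def)

text \<open>Replaces the list of pairs in the definition of \<open>L1\<close> by an inductive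
  predicate that unfolds at a \<open>cons_trm\<close>.\<close>

lemma literal_list_iff:
  "(\<exists>ps. s = list_trm (map (\<lambda>(t, t'). t \<ominus> t') ps)) \<longleftrightarrow> list_of (\<lambda>h. \<exists>p v. h = p \<ominus> v) s"
  (is "?l \<longleftrightarrow> ?r")
proof
  assume ?l
  then obtain ps where "s = list_trm (map (\<lambda>(t, t'). t \<ominus> t') ps)" ..
  then show ?r by (induction ps arbitrary: s) auto
next
  assume ?r
  then show ?l
  proof induction
    case 1
    then show ?case by (auto intro: exI[of _ "[]"])
  next
    case (2 h t)
    then obtain p v ps where "h = p \<ominus> v" "t = list_trm (map (\<lambda>(t, t'). t \<ominus> t') ps)" by blast
    then show ?case by (intro exI[of _ "(p, v) # ps"]) simp
  qed
qed

lemma L1_HU: "s \<in> L1 F \<Longrightarrow> s \<in> HU F"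
  by (simp add: L1_def)

text \<open>The matching literal is the head or lies in the tail. In the first case the tail may
  fail to be in \<open>L1\<close>, so its being a list of literals is recorded separately.\<close>

lemma L1_cons_iff:
  "cons_trm h s \<in> L1 F \<longleftrightarrow> cons_trm h s \<in> HU F \<and> list_of (\<lambda>h. \<exists>p v. h = p \<ominus> v) s \<and>
     (\<exists>p v. h = p \<ominus> v \<and> (p = v \<or> s \<in> L1 F))"
  (is "?l \<longleftrightarrow> ?r")
proof
  assume l: ?l
  then obtain ps where ps: "cons_trm h s = list_trm (map (\<lambda>(t, t'). t \<ominus> t') ps)"
    and ex: "\<exists>(t, t')\<in>set ps. t = t'" unfolding L1_def by blast
  from ps obtain p v qs where q: "ps = (p, v) # qs" "h = p \<ominus> v"
    "s = list_trm (map (\<lambda>(t, t'). t \<ominus> t') qs)" by (cases ps) auto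
  have hu: "cons_trm h s \<in> HU F" using l by (rule L1_HU)
  have "s \<in> L1 F" if "p \<noteq> v"
    using ex that hu unfolding L1_def q by (fastforce intro!: exI[of _ qs])
  then show ?r using hu q literal_list_iff[of s] by blast
next
  assume r: ?r
  then obtain p v where h: "h = p \<ominus> v" "p = v \<or> s \<in> L1 F" by blast
  obtain ps where ps: "s = list_trm (map (\<lambda>(t, t'). t \<ominus> t') ps)" "p = v \<or> (\<exists>(t, t')\<in>set ps. t = t')"
  proof (cases "s \<in> L1 F")
    case True
    then show thesis using that unfolding L1_def by blast
  next
    case False
    then show thesis using that r h literal_list_iff[of s] by blast
  qed
  then have "cons_trm h s = list_trm (map (\<lambda>(t, t'). t \<ominus> t') ((p, v) # ps))"
    "\<exists>(t, t')\<in>set ((p, v) # ps). t = t'" using h by auto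
  then show ?l using r unfolding L1_def by blast
qed

lemma L1_cases:
  assumes "s \<in> L1 F"
  obtains p v r where "s = cons_trm (p \<ominus> v) r"
proof -
  from assms obtain ps where "s = list_trm (map (\<lambda>(t, t'). t \<ominus> t') ps)" "ps \<noteq> []"
    unfolding L1_def by blast
  then show thesis using that by (cases ps) auto
qed

lemma nil_notin_L1: "nil_trm \<notin> L1 F"
  by (auto elim: L1_cases)

lemma L1_single: "cons_trm (p \<ominus> v) nil_trm \<in> L1 F \<Longrightarrow> p = v"
  by (simp add: L1_cons_iff nil_notin_L1)

lemma L1_tail_cases:
  assumes "cons_trm h s \<in> L1 F"
  obtains "s = nil_trm" | p2 v2 r where "s = cons_trm (p2 \<ominus> v2) r"
proof -
  from assms have "list_of (\<lambda>h. \<exists>p v. h = p \<ominus> v) s" by (simp add: L1_cons_iff)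
  then show thesis by cases (use that in blast)+
qed

lemma L1_swap:
  "cons_trm (p1 \<ominus> v1) (cons_trm (p2 \<ominus> v2) s) \<in> L1 F \<Longrightarrow>
   cons_trm (p2 \<ominus> v2) (cons_trm (p1 \<ominus> v1) s) \<in> L1 F"
  by (auto simp: L1_cons_iff)

lemma L1_tail: "cons_trm (p \<ominus> v) s \<in> L1 F \<Longrightarrow> p \<noteq> v \<Longrightarrow> s \<in> L1 F"
  by (simp add: L1_cons_iff)

lemma L2_cases:
  assumes "u \<in> L2 F"
  obtains "u = nil_trm" | c cs where "u = cons_trm c cs" "c \<in> L1 F" "cs \<in> L2 F"
proof -
  from assms obtain ss where ss: "u = list_trm ss" "set ss \<subseteq> L1 F" by (auto simp: L2_def)
  show thesis
  proof (cases ss)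
    case Nil
    with ss that(1) show thesis by simp
  next
    case (Cons c cs)
    with ss have "list_trm cs \<in> L2 F" by (auto simp: L2_def)
    with Cons ss that(2) show thesis by simp
  qed
qed

lemma TFL_cases:
  assumes "l \<in> TFL"
  obtains "l = nil_trm" | v vs where "l = cons_trm v vs" "truth_val v" "vs \<in> TFL"
proof -
  from assms obtain ts where ts: "l = list_trm ts" "set ts \<subseteq> {true_trm, false_trm}"
    by (auto simp: TFL_def)
  show thesis
  proof (cases ts)
    case Nil
    with ts that(1) show thesis by simp
  next
    case (Cons v vs)
    with ts have "list_trm vs \<in> TFL" "truth_val v" by (auto simp: TFL_def truth_val_def)
    with Cons ts that(2) show thesis by simp
  qed
qed

lemma list_trm_HU: "set ts \<subseteq> HU F \<Longrightarrow> list_trm ts \<in> HU F"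
  by (induction ts) auto

lemma L2_HU: "u \<in> L2 F \<Longrightarrow> u \<in> HU F"
  by (auto simp: L2_def L1_HU intro!: list_trm_HU)

lemma TFL_HU: "l \<in> TFL \<Longrightarrow> l \<in> HU F"
  by (auto simp: TFL_def intro!: list_trm_HU)

section \<open>Resolution of ground atoms\<close>

text \<open>The weights are chosen so that resolving a ground atom with a rule of \<open>P3\<close> decreases the sum.\<close>

definition weight :: "('f, 'p) atom \<Rightarrow> nat" where
  "weight A =
     (case args A of
        [] \<Rightarrow> 0
      | t # ts \<Rightarrow>
         (case pred A of
            Sat \<Rightarrow> 1 + 4 * size t + 4 * size (hd ts)
          | Sat_cnf \<Rightarrow> 4 * size t
          | Sat_cl \<Rightarrow> 4 * size t
          | Sat_cl3 \<Rightarrow> 4 * size t + 1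
          | Sat_cl5 \<Rightarrow> 4 * size (last ts) + 3
          | Sat_cl5a \<Rightarrow> 4 * size (last ts) + 2
          | Tflist \<Rightarrow> 4 * size t
          | _ \<Rightarrow> 1))"

definition query_weight :: "('f, 'p) query \<Rightarrow> nat" where
  "query_weight G = sum_list (map weight G)"

text \<open>\<tau> is a raw assignment to the rule's variables; \<open>variant_unifier\<close> later
  turns it into a substitution with finite domain.\<close>

definition resolves ::
  "('f \<times> nat) set \<Rightarrow> ('f, 'p) clause \<Rightarrow> 'f subst \<Rightarrow> ('f, 'p) atom \<Rightarrow> bool" where
  "resolves F c \<tau> B \<longleftrightarrow> (\<forall>x. wf_trm F (\<tau> x)) \<and> subst_atom \<tau> (head c) = B \<and>
     set (subst_query \<tau> (body c)) \<subseteq> S30 F \<and> query_weight (subst_query \<tau> (body c)) < weight B"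

lemma Pi5_mem:
  "(sat_cnf nil_trm :- []) \<in> Pi5"
  "(sat_cnf (cons_trm (Var ''C'') (Var ''Cs'')) :- [sat_cl (Var ''C''), sat_cnf (Var ''Cs'')]) \<in> Pi5"
  "(sat_cl (cons_trm (Var ''P'' \<ominus> Var ''V'') (Var ''R'')) :-
     [sat_cl3 (Var ''R'') (Var ''V'') (Var ''P'')]) \<in> Pi5"
  "(eq (Var ''X'') (Var ''X'') :- []) \<in> Pi5"
  "(sat_cl3 nil_trm (Var ''V'') (Var ''P'') :- [eq (Var ''V'') (Var ''P'')]) \<in> Pi5"
  "(sat_cl3 (cons_trm (Var ''P2'' \<ominus> Var ''V2'') (Var ''R'')) (Var ''V1'') (Var ''P1'') :-
     [sat_cl5 (Var ''V1'') (Var ''P1'') (Var ''V2'') (Var ''P2'') (Var ''R'')]) \<in> Pi5"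
  "(sat (Var ''Cs'') (Var ''Vs'') :- [sat_cnf (Var ''Cs''), tflist (Var ''Vs'')]) \<in> Pi5"
  "(tflist nil_trm :- []) \<in> Pi5"
  "(tflist (cons_trm (Var ''V'') (Var ''Vs'')) :- [tflist (Var ''Vs''), tf (Var ''V'')]) \<in> Pi5"
  "(tf true_trm :- []) \<in> Pi5"
  "(tf false_trm :- []) \<in> Pi5"
  by (simp_all add: Pi5_def P3_def Pi1_def Pi2_def Pi3_def Pi4_def
      rule7_def rule8_def rule9_def rule10_def)

text \<open>The point is that the control looks at the possibly nonground \<open>A\<close>, yet
  selects a program with a rule suitable for the ground instance. In the loop through
  \<open>sat_cl5\<close>, \<open>sat_cl5a\<close> and \<open>sat_cl3\<close> the offsets of
  \<open>weight\<close> fall from 3 to 2 to 1, and the factor 4 pays for the return to 3 when a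
  literal is removed.\<close>

lemma ground_resolves:
  assumes sh: "shape A" and B: "subst_atom \<eta> A \<in> S30 F"
  shows "\<exists>c\<in>control_program F A. \<exists>\<tau>. resolves F c \<tau> (subst_atom \<eta> A)"
proof -
  have P5: "control_program F A = Pi5" if "pred A \<noteq> Sat_cl5" "pred A \<noteq> Sat_cl5a"
    using that by (simp add: control_program_def)
  have pr: "pred A = pred (subst_atom \<eta> A)" by (simp add: subst_atom_def)
  have wf: "\<And>t. t \<in> HU F \<Longrightarrow> wf_trm F t" by (simp add: HU_def)
  note res = resolves_def subst_atom_def subst_query_def query_weight_def weight_def
  from B show ?thesis
  proof cases
    case (1 s)
    then obtain p v r where s: "s = cons_trm (p \<ominus> v) r" by (blast elim: L1_cases)
    with 1 have "p \<in> HU F" "v \<in> HU F" "r \<in> HU F" using L1_HU by fastforce+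
    then have "resolves F (sat_cl (cons_trm (Var ''P'' \<ominus> Var ''V'') (Var ''R'')) :-
        [sat_cl3 (Var ''R'') (Var ''V'') (Var ''P'')])
        (Var(''P'' := p, ''V'' := v, ''R'' := r)) (subst_atom \<eta> A)"
      unfolding 1(1) using 1(2) s by (auto simp: res wf S30.intros)
    moreover have "control_program F A = Pi5" using P5 pr 1 by simp
    ultimately show ?thesis using Pi5_mem by metis
  next
    case (2 u)
    have *: "control_program F A = Pi5" using P5 pr 2 by simp
    note A\<eta> = 2(1)
    from 2(2) show ?thesis
    proof (cases rule: L2_cases)
      case 1
      have "resolves F (sat_cnf nil_trm :- []) Var (subst_atom \<eta> A)"
        unfolding A\<eta> 1 by (auto simp: res)
      then show ?thesis using * Pi5_mem by metis
    next
      case (2 c cs)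
      then have "resolves F (sat_cnf (cons_trm (Var ''C'') (Var ''Cs'')) :-
          [sat_cl (Var ''C''), sat_cnf (Var ''Cs'')])
          (Var(''C'' := c, ''Cs'' := cs)) (subst_atom \<eta> A)"
        unfolding A\<eta> by (auto simp: res wf L1_HU L2_HU S30.intros)
      then show ?thesis using * Pi5_mem by metis
    qed
  next
    case (3 t)
    then have "resolves F (eq (Var ''X'') (Var ''X'') :- []) (Var(''X'' := t)) (subst_atom \<eta> A)"
      by (auto simp: res wf)
    moreover have "control_program F A = Pi5" using P5 pr 3 by simp
    ultimately show ?thesis using Pi5_mem by metis
  next
    case (4 p v s)
    have *: "control_program F A = Pi5" using P5 pr 4 by simp
    have hu: "p \<in> HU F" "v \<in> HU F" "s \<in> HU F" using L1_HU[OF 4(2)] by auto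
    from 4(2) show ?thesis
    proof (cases rule: L1_tail_cases)
      case 1
      \<comment> \<open>The last remaining literal must be the match, so the equation in the body of
        rule 5 holds.\<close>
      with 4 have "p = v" using L1_single by blast
      then have "resolves F (sat_cl3 nil_trm (Var ''V'') (Var ''P'') :- [eq (Var ''V'') (Var ''P'')])
          (Var(''V'' := v, ''P'' := p)) (subst_atom \<eta> A)"
        using 4 1 hu by (auto simp: res wf S30.intros)
      then show ?thesis using * Pi5_mem by metis
    next
      case (2 p2 v2 r)
      then have "resolves F (sat_cl3 (cons_trm (Var ''P2'' \<ominus> Var ''V2'') (Var ''R'')) (Var ''V1'') (Var ''P1'') :-
          [sat_cl5 (Var ''V1'') (Var ''P1'') (Var ''V2'') (Var ''P2'') (Var ''R'')])
          (Var(''V1'' := v, ''P1'' := p, ''V2'' := v2, ''P2'' := p2, ''R'' := r)) (subst_atom \<eta> A)"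
        using 4 hu by (auto simp: res wf S30.intros)
      then show ?thesis using * Pi5_mem by metis
    qed
  next
    case (5 p1 v1 p2 v2 s)
    let ?\<tau> = "Var(''V1'' := v1, ''P1'' := p1, ''V2'' := v2, ''P2'' := p2, ''R'' := s)"
    have "resolves F rule7 ?\<tau> (subst_atom \<eta> A)" "resolves F rule8 ?\<tau> (subst_atom \<eta> A)"
      using 5 L1_HU[OF 5(2)] L1_swap[OF 5(2)] by (auto simp: res wf rule7_def rule8_def S30.intros)
    then show ?thesis using pr 5 by (auto simp: control_program_def Pi1_def Pi2_def)
  next
    case (6 p1 v1 p2 v2 s)
    let ?\<tau> = "Var(''V1'' := v1, ''P1'' := p1, ''V2'' := v2, ''P2'' := p2, ''R'' := s)"
    from sh pr 6(1) obtain v1' p1' v2' p2' s'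
      where A: "A = sat_cl5a v1' p1' v2' p2' s'" "truth_val v1'" "truth_val p1'"
      by cases auto
    \<comment> \<open>Truth values are ground, so the test made on \<open>A\<close> already sees the
      arguments of the ground instance.\<close>
    with 6(1) have e: "v1' = v1" "p1' = p1" by (auto simp: subst_atom_def truth_val_subst)
    \<comment> \<open>The identity unifies equal terms; distinct truth values have no
      unifier.\<close>
    have "is_subst F Var" by (simp add: is_subst_def subst_dom_def)
    then have u: "unifiable_trms F v1 p1 \<longleftrightarrow> v1 = p1"
      using A e by (auto simp: unifiable_trms_def truth_val_subst)
    show ?thesis
    proof (cases "v1 = p1")
      case True
      then have "resolves F rule9 ?\<tau> (subst_atom \<eta> A)"
        using 6 L1_HU[OF 6(2)] by (auto simp: res wf rule9_def S30.intros)
      then show ?thesis using True A e u by (auto simp: control_program_def Pi3_def)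
    next
      case False
      \<comment> \<open>The first literal does not match, so a match lies in the tail, which is what
        rule 10 passes on.\<close>
      then have "resolves F rule10 ?\<tau> (subst_atom \<eta> A)"
        using 6 L1_HU[OF 6(2)] L1_tail[OF 6(2)] by (auto simp: res wf rule10_def S30.intros)
      then show ?thesis using False A e u by (auto simp: control_program_def Pi4_def)
    qed
  next
    case (7 u t)
    then have "resolves F (sat (Var ''Cs'') (Var ''Vs'') :- [sat_cnf (Var ''Cs''), tflist (Var ''Vs'')])
        (Var(''Cs'' := u, ''Vs'' := t)) (subst_atom \<eta> A)"
      by (auto simp: res wf L2_HU TFL_HU S30.intros)
    moreover have "control_program F A = Pi5" using P5 pr 7 by simp
    ultimately show ?thesis using Pi5_mem by metis
  next
    case (8 t)
    have *: "control_program F A = Pi5" using P5 pr 8 by simp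
    from 8(2) show ?thesis
    proof (cases rule: TFL_cases)
      case 1
      have "resolves F (tflist nil_trm :- []) Var (subst_atom \<eta> A)"
        unfolding 8(1) 1 by (auto simp: res)
      then show ?thesis using * Pi5_mem by metis
    next
      case (2 v vs)
      then have "resolves F (tflist (cons_trm (Var ''V'') (Var ''Vs'')) :- [tflist (Var ''Vs''), tf (Var ''V'')])
          (Var(''V'' := v, ''Vs'' := vs)) (subst_atom \<eta> A)"
        using 8 by (auto simp: res wf TFL_HU truth_val_def fun_alphabet_def S30.intros)
      then show ?thesis using * Pi5_mem by metis
    qed
  next
    case 9
    then have "resolves F (tf true_trm :- []) Var (subst_atom \<eta> A)" by (auto simp: res)
    moreover have "control_program F A = Pi5" using P5 pr 9 by simp
    ultimately show ?thesis using Pi5_mem by metis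
  next
    case 10
    then have "resolves F (tf false_trm :- []) Var (subst_atom \<eta> A)" by (auto simp: res)
    moreover have "control_program F A = Pi5" using P5 pr 10 by simp
    ultimately show ?thesis using Pi5_mem by metis
  qed
qed


section \<open>Lifting ground resolution to the tree\<close>

lemma foldr_comp_Cons: "foldr (\<circ>\<^sub>s) (\<theta> # \<theta>s) Var x = subst_trm (foldr (\<circ>\<^sub>s) \<theta>s Var) (\<theta> x)"
  by (simp add: subst_comp_def)

text \<open>Induction is on the weight of the ground instance, as the tree may be infinite. The
  equation is claimed on all of \<open>V\<close>, since images of variables under earlier mgus may
  contain variables that no longer occur in the node.\<close>

lemma lifting:
  assumes "c_selection_rule F Ps {Pi1, Pi2, Pi3, Pi4, Pi5} sel" "implements_control F Ps sel"
    and "cs_sld_subtree F sel V T" "finite V" "vars_query (label T) \<subseteq> V"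
    and "invar (label T) \<eta>" "is_subst F \<eta>" "set (subst_query \<eta> (label T)) \<subseteq> S30 F"
  shows "\<exists>\<theta>s \<sigma>. successful_branch T \<theta>s \<and> is_subst F \<sigma> \<and>
    (\<forall>x\<in>V. \<eta> x = subst_trm \<sigma> (foldr (\<circ>\<^sub>s) \<theta>s Var x))"
  using assms(3-8)
proof (induction "query_weight (subst_query \<eta> (label T))" arbitrary: V T \<eta> rule: less_induct)
  case less
  note IH = less.hyps and V = less.prems(2,3) and inv = less.prems(4)
    and \<eta> = less.prems(5) and S = less.prems(6)
  from less.prems(1) show ?case
  proof cases
    case empty
    then have "successful_branch T []" by (auto intro: successful_branch.intros)
    with \<eta> show ?thesis by (intro exI[of _ "[]"] exI[of _ \<eta>]) simp
  next
    case (resolve G i P ch)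
    let ?A = "G ! i"
    have lab: "label T = G" and chT: "children T = ch" by (simp_all add: resolve)
    have wfG: "wf_query F Ps G"
      using inv lab by (auto simp: wf_query_def invar_def intro: shape_wf)
    have i: "i < length G"
      using assms(1) wfG resolve(2,3) unfolding c_selection_rule_def by force
    then have AG: "?A \<in> set G" by simp
    \<comment> \<open>This excludes the case in which the control selects the empty program.\<close>
    have "\<not> (\<forall>B\<in>set G. delayed B)"
      using invar_imp_not_delayed[OF inv] lab resolve(2) by auto
    then have nd: "\<not> delayed ?A" and P: "P = control_program F ?A"
      using assms(2) wfG resolve(2,3) unfolding implements_control_def by metis+
    have "subst_atom \<eta> ?A \<in> S30 F" using S lab AG by (auto simp: subst_query_def)
    moreover have "shape ?A" using inv lab AG by (auto simp: invar_def)
    ultimately obtain c \<tau> where c: "c \<in> P" and \<tau>: "resolves F c \<tau> (subst_atom \<eta> ?A)"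
      using ground_resolves P by blast
    have vA: "vars_atom ?A \<subseteq> V" using AG V lab by (auto simp: vars_query_def)
    have \<tau>wf: "\<And>x. wf_trm F (\<tau> x)" using \<tau> by (simp add: resolves_def)
    \<comment> \<open>Proved for every variant: one fresh variant shows that the child exists, and
      the claim is used again for the variant that the tree employs.\<close>
    have unif: "\<exists>\<mu>. is_unifier F \<mu> ?A (head c') \<and> (\<forall>x\<in>V. \<mu> x = \<eta> x) \<and>
        subst_query \<mu> (body c') = subst_query \<tau> (body c)"
      if v: "variant c c'" "vars_clause c' \<inter> V = {}" for c'
    proof -
      obtain \<mu> where \<mu>: "is_subst F \<mu>" "\<forall>x\<in>V. \<mu> x = \<eta> x"
        "subst_atom \<mu> (head c') = subst_atom \<tau> (head c)"
        "subst_query \<mu> (body c') = subst_query \<tau> (body c)"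
        by (rule variant_unifier[OF v \<eta> \<tau>wf])
      have "subst_atom \<mu> ?A = subst_atom \<eta> ?A" using vA \<mu>(2) by (auto intro: subst_atom_cong)
      with \<mu> \<tau> show ?thesis by (auto simp: is_unifier_def resolves_def)
    qed
    moreover obtain c0 where "variant c c0" "vars_clause c0 \<inter> V = {}"
      using ex_variant_disjoint[OF V(1)] by metis
    ultimately have "\<exists>c' \<sigma>. variant c c' \<and> vars_clause c' \<inter> V = {} \<and> is_unifier F \<sigma> ?A (head c')"
      by metis
    then have "ch c \<noteq> None" using resolve(4) c by simp
    then obtain c' \<theta> T' where ch: "ch c = Some (c', \<theta>, T')" by auto
    then have var: "variant c c'" "vars_clause c' \<inter> V = {}" and mgu: "is_mgu F \<theta> ?A (head c')"
      and lab': "label T' = resolvent G i c' \<theta>"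
      and T': "cs_sld_subtree F sel (V \<union> vars_clause c' \<union> subst_vars \<theta>) T'"
      using resolve(5) by blast+
    let ?V' = "V \<union> vars_clause c' \<union> subst_vars \<theta>"
    obtain \<mu> where \<mu>: "is_unifier F \<mu> ?A (head c')" "\<forall>x\<in>V. \<mu> x = \<eta> x"
      "subst_query \<mu> (body c') = subst_query \<tau> (body c)"
      using unif[OF var] by blast
    \<comment> \<open>The mgu property yields \<gamma>, the substitution to be lifted at the
      child.\<close>
    then obtain \<gamma> where \<gamma>: "is_subst F \<gamma>" "\<mu> = \<theta> \<circ>\<^sub>s \<gamma>" using mgu by (auto simp: is_mgu_def)
    have \<theta>: "is_subst F \<theta>" "subst_atom \<theta> ?A = subst_atom \<theta> (head c')"
      using mgu by (auto simp: is_mgu_def is_unifier_def)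
    have \<eta>\<gamma>: "\<eta> x = subst_trm \<gamma> (\<theta> x)" if "x \<in> V" for x
      using \<mu>(2) \<gamma>(2) that by (auto simp: subst_comp_def)
    have inv': "invar (label T') \<gamma>"
      unfolding lab' by (rule resolvent_invar[OF inv[unfolded lab] i nd c[unfolded P] var(1) \<theta>(2)])
        (use lab \<eta>\<gamma> V in auto)
    have G: "G = take i G @ ?A # drop (Suc i) G" using i by (rule id_take_nth_drop)
    have "subst_query \<mu> G = subst_query \<eta> G"
      using \<mu>(2) V lab by (auto intro: subst_query_cong)
    then have \<mu>G: "subst_query \<mu> (take i G) = subst_query \<eta> (take i G)"
      "subst_query \<mu> (drop (Suc i) G) = subst_query \<eta> (drop (Suc i) G)"
      by (auto simp: subst_query_def dest: in_set_takeD in_set_dropD)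
    \<comment> \<open>The instance of the child under \<gamma> is exactly the ground resolvent, so
      membership in the specification and the drop in weight come from
      \<open>resolves\<close>.\<close>
    have G': "subst_query \<gamma> (label T') = subst_query \<eta> (take i G) @ subst_query \<tau> (body c) @
        subst_query \<eta> (drop (Suc i) G)"
      unfolding lab' resolvent_def
      by (simp add: \<mu>(3) \<mu>G flip: subst_query_comp \<gamma>(2))
    have \<eta>G: "subst_query \<eta> G = subst_query \<eta> (take i G) @ subst_atom \<eta> ?A #
        subst_query \<eta> (drop (Suc i) G)"
      by (subst G) (simp add: subst_query_def)
    have "query_weight (subst_query \<gamma> (label T')) < query_weight (subst_query \<eta> (label T))"
      using \<tau> unfolding G' lab \<eta>G by (simp add: query_weight_def resolves_def)
    moreover note T'
    moreover have "finite ?V'" using V(1) finite_vars_clause finite_subst_vars[OF \<theta>(1)] by blast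
    moreover have "vars_query (label T') \<subseteq> ?V'"
    proof
      fix y assume "y \<in> vars_query (label T')"
      then obtain x where x: "x \<in> vars_query (take i G @ body c' @ drop (Suc i) G)"
        "y \<in> vars_trm (\<theta> x)"
        unfolding lab' resolvent_def by (auto simp: vars_query_def subst_query_def vars_subst_atom)
      have "vars_query (take i G @ body c' @ drop (Suc i) G) \<subseteq> V \<union> vars_clause c'"
        using V(2) lab by (auto simp: vars_query_def vars_clause_def dest: in_set_takeD in_set_dropD)
      then show "y \<in> ?V'" using x vars_trm_subset_subst_vars[of \<theta> x] by blast
    qed
    moreover note inv' \<gamma>(1)
    moreover have "set (subst_query \<gamma> (label T')) \<subseteq> S30 F"
      using S \<tau> unfolding G' lab \<eta>G by (auto simp: resolves_def)
    ultimately obtain \<theta>s \<sigma> where IH': "successful_branch T' \<theta>s" "is_subst F \<sigma>"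
      "\<forall>x\<in>?V'. \<gamma> x = subst_trm \<sigma> (foldr (\<circ>\<^sub>s) \<theta>s Var x)"
      using IH by blast
    have "\<eta> x = subst_trm \<sigma> (foldr (\<circ>\<^sub>s) (\<theta> # \<theta>s) Var x)" if "x \<in> V" for x
    proof -
      \<comment> \<open>The induction hypothesis describes \<gamma> on \<open>?V'\<close>, hence on
        all variables of \<open>\<theta> x\<close>; prefixing the mgu then recovers \<eta>.\<close>
      have "vars_trm (\<theta> x) \<subseteq> ?V'" using that vars_trm_subset_subst_vars[of \<theta> x] by blast
      then have "subst_trm \<gamma> (\<theta> x) = subst_trm (foldr (\<circ>\<^sub>s) \<theta>s Var \<circ>\<^sub>s \<sigma>) (\<theta> x)"
        using IH'(3) by (intro subst_trm_cong) (auto simp: subst_comp_def)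
      then show ?thesis using \<eta>\<gamma>[OF that] unfolding foldr_comp_Cons by (simp add: subst_trm_comp)
    qed
    moreover have "successful_branch T (\<theta> # \<theta>s)"
      using ch chT IH'(1) by (metis successful_branch.intros(2))
    ultimately show ?thesis using IH'(2) by blast
  qed
qed

section \<open>Lists as terms and the root query\<close>

lemma list_of_list_trm: "(\<And>t. t \<in> set ts \<Longrightarrow> P t) \<Longrightarrow> list_of P (list_trm ts)"
  by (induction ts) auto

lemma vars_list_trm: "vars_trm (list_trm ts) = (\<Union>t\<in>set ts. vars_trm t)"
  by (induction ts) auto

lemma subst_list_trm: "subst_trm \<sigma> (list_trm ts) = list_trm (map (subst_trm \<sigma>) ts)"
  by (induction ts) auto

lemma list_trm_inject [simp]: "list_trm ss = list_trm ts \<longleftrightarrow> ss = ts"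
proof (induction ss arbitrary: ts)
  case Nil
  then show ?case by (cases ts) auto
next
  case (Cons s ss)
  then show ?case by (cases ts) auto
qed

lemma list_of_rep_cnf: "list_of (list_of lit) (rep_cnf \<rho> \<phi>)"
proof -
  have "lit (rep_lit \<rho> x)" for x by (cases x) (auto simp: truth_val_def simple_def)
  then show ?thesis unfolding rep_cnf_def by (auto intro!: list_of_list_trm)
qed

theorem mainTheorem6:
  fixes F :: "('f \<times> nat) set" and Ps :: "('p \<times> nat) set"
    and \<phi> :: "'x cnf" and \<rho> :: "'x \<Rightarrow> var"
    and u l :: "'f trm" and vs :: "var list"
    and Q :: "('f, 'p) query"
    and sel :: "('f, 'p) c_selection" and T :: "('f, 'p) sld_tree"
  assumes "inj_on \<rho> (cnf_vars \<phi>)"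
    and "u = rep_cnf \<rho> \<phi>"
    and "set vs = vars_trm u" and "l = list_trm (map Var vs)"
    and "Q = [sat u l]"
    and "c_selection_rule F Ps {Pi1, Pi2, Pi3, Pi4, Pi5} sel"
    and "implements_control F Ps sel"
    and "cs_sld_tree F sel Q T"
  shows "complete_tree F T (S30 F)"
  unfolding complete_tree_def
proof (intro allI impI, elim conjE)
  fix \<eta>
  assume \<eta>: "is_subst F \<eta>" and S: "set (subst_query \<eta> (label T)) \<subseteq> S30 F"
  have T: "label T = Q" "cs_sld_subtree F sel (vars_query Q) T"
    using assms(8) by (auto simp: cs_sld_tree_def)
  have vl: "vars_trm l = set vs" by (auto simp: assms(4) vars_list_trm)
  then have vQ: "vars_query Q = set vs" using assms(3,5) by (auto simp: vars_query_def vars_atom_def)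
  have "sat (subst_trm \<eta> u) (subst_trm \<eta> l) \<in> (S30 F :: ('f, 'p) atom set)"
    using S T(1) assms(5) by (auto simp: subst_query_def subst_atom_def)
  \<comment> \<open>The specification makes the instance of \<open>l\<close> a list of truth values,
    so \<eta> assigns a truth value to each variable of the formula.\<close>
  then have "subst_trm \<eta> l \<in> TFL" by cases auto
  then have "\<forall>x\<in>set vs. truth_val (\<eta> x)"
    by (auto simp: TFL_def assms(4) subst_list_trm truth_val_def)
  moreover have "list_of simple l"
    unfolding assms(4) by (rule list_of_list_trm) (auto simp: simple_def)
  \<comment> \<open>\<open>l\<close> lists all variables of \<open>u\<close>, so the
    \<open>sat\<close>-atom covers every variable of the root through its second argument.\<close>
  ultimately have "invar (label T) \<eta>"
    unfolding T(1) invar_def vQ using list_of_rep_cnf[of \<rho> \<phi>] assms(2,5) vl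
    by (auto simp: cov_def cov_args_def)
  from lifting[OF assms(6,7) T(2) finite_vars_query _ this \<eta> S] T(1)
  obtain \<theta>s \<sigma> where b: "successful_branch T \<theta>s" "is_subst F \<sigma>"
    "\<forall>x\<in>vars_query Q. \<eta> x = subst_trm \<sigma> (foldr (\<circ>\<^sub>s) \<theta>s Var x)" by auto
  let ?\<alpha> = "computed_answer_subst Q \<theta>s"
  have "subst_query \<eta> Q = subst_query (?\<alpha> \<circ>\<^sub>s \<sigma>) Q"
    by (rule subst_query_cong)
      (use b(3) in \<open>auto simp: computed_answer_subst_def subst_restrict_def subst_comp_def\<close>)
  moreover have "subst_query ?\<alpha> Q \<in> answers T"
    using b(1) T(1) by (auto simp: answers_def)
  ultimately show "\<exists>G\<in>answers T. \<exists>\<sigma>. is_subst F \<sigma> \<and> subst_query \<eta> (label T) = subst_query \<sigma> G"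
    using b(2) T(1) by (auto simp: subst_query_comp)
qed

end
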